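(* For all integers $\alpha\geq 1$ and all integers $n\geq 0$, $$pend\left(3^{2\alpha+1}n+\frac{17\cdot 3^{2\alpha}-1}{8}\right) \equiv 0 \pmod{3}.$$
   Context: A PEND partition is an integer partition in which the even parts are not allowed to be distinct, i.e., no even part appears with multiplicity exactly one (every even part that occurs appears at least twice), while the odd parts are unrestricted. For an integer $n\geq 0$, $pend(n)$ denotes the number of PEND partitions of weight $n$, i.e., PEND partitions whose parts sum to $n$ (the empty partition is counted, so $pend(0)=1$). *)

theory Defs
  imports "HOL-Library.Multiset" "HOL-Number_Theory.Cong"
begin

definition partitions :: "nat \<Rightarrow> nat multiset set" where
  "partitions n = {P. 0 \<notin># P \<and> \<Sum>\<^sub># P = n}"

definition PEND :: "nat multiset \<Rightarrow> bool" where
  "PEND P \<longleftrightarrow> (\<forall>k. even k \<longrightarrow> count P k \<noteq> 1)"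

definition pend :: "nat \<Rightarrow> nat" where
  "pend n = card {P \<in> partitions n. PEND P}"

lemma finite_partitions: "finite (partitions n)"
proof (rule finite_subset)
  let ?L = "{xs. set xs \<subseteq> {..n} \<and> length xs \<le> n}"
  show "partitions n \<subseteq> mset ` ?L"
  proof
    fix P assume "P \<in> partitions n"
    then have pos: "0 \<notin># P" and sum: "\<Sum>\<^sub># P = n"
      by (auto simp: partitions_def)
    have size: "size P \<le> \<Sum>\<^sub># P"
      using pos by (induction P) auto
    have le: "x \<le> n" if "x \<in># P" for x
      using that sum by (metis le_add1 multi_member_split sum_mset.add_mset)
    obtain xs where xs: "mset xs = P"
      using ex_mset by blast
    have "set xs = set_mset P" "length xs = size P"
      using xs by auto
    with le size sum have "xs \<in> ?L"
      by auto
    with xs show "P \<in> mset ` ?L"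
      by blast
  qed
  show "finite (mset ` ?L)"
    by (intro finite_imageI finite_lists_length_le) simp
qed

(* The division by 8 in the argument of pend is exact. *)
lemma eight_dvd: "8 dvd 17 * 3 ^ (2 * \<alpha>) - (1::nat)"
proof -
  have "[9 ^ \<alpha> = 1 ^ \<alpha>] (mod (8::nat))"
    by (rule cong_pow) (simp add: cong_def)
  then have "[17 * 9 ^ \<alpha> = 17 * 1] (mod (8::nat))"
    by (intro cong_mult) auto
  then have "[17 * 9 ^ \<alpha> = 1] (mod (8::nat))"
    by (simp add: cong_def)
  then show ?thesis
    by (simp add: power_mult cong_altdef_nat)
qed

end

theory Submission
  imports Defs "HOL-Computational_Algebra.Formal_Power_Series"
begin

text \<open>
  Write \<open>f\<^sub>k\<close> for the product of all \<open>1 - q\<^bsup>kj\<^esup>\<close>, \<open>j \<ge> 1\<close>. Modulo 3 an even part \<open>k\<close> contributes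
  \<open>(1 - q\<^bsup>k\<^esup> + q\<^bsup>2k\<^esup>) / (1 - q\<^bsup>k\<^esup>) = (1 + q\<^bsup>k\<^esup>)\<^sup>2 / (1 - q\<^bsup>k\<^esup>)\<close> to the generating function, so that
  \<open>\<Sum> pend(n) q\<^sup>n = f\<^sub>4\<^sup>2 / (f\<^sub>1 f\<^sub>2\<^sup>2) = \<psi>(-q)\<^sup>2 / f\<^sub>1\<^sup>3\<close> over the field with three elements, where
  \<open>f\<^sub>1\<^sup>3\<close> is a series in \<open>q\<^sup>3\<close>. Dissecting \<open>\<psi>\<close> and \<open>\<phi>\<close> modulo 3 and rewriting the dissection factors
  with the Jacobi triple product leads to
  \<open>\<Sum> pend(9n + 1) q\<^sup>n = \<psi>(q) \<phi>(-q\<^sup>2)\<^sup>6 = \<psi>(q) \<phi>(-q\<^sup>6)\<^sup>2\<close>. This series \<open>\<Sum> c(n) q\<^sup>n\<close> satisfies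
  \<open>c(3n + 2) = 0\<close> and \<open>c(9n + 1) = c(n)\<close>, which gives the theorem by induction on \<open>\<alpha>\<close>.
\<close>

subsection \<open>Limits of formal power series\<close>

text \<open>This instance and the next make the general limit rules for sums, products and powers
  available for power series.\<close>

instance fps :: (ab_group_add) topological_ab_group_add
proof
  fix a b :: "'a fps"
  have "\<forall>\<^sub>F x in nhds a \<times>\<^sub>F nhds b. fps_nth (fst x + snd x) n = fps_nth (a + b) n" for n
    using eventually_prodI[OF eventually_fps_nth_eq_nhds_fps[of n a] eventually_fps_nth_eq_nhds_fps[of n b]]
    by eventually_elim simp
  then show "LIM x (nhds a \<times>\<^sub>F nhds b). fst x + snd x :> nhds (a + b)"
    by (rule tendsto_fpsI)
  have "\<forall>\<^sub>F x in nhds a. fps_nth (- x) n = fps_nth (- a) n" for n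
    using eventually_fps_nth_eq_nhds_fps[of n a] by eventually_elim simp
  then show "(uminus \<longlongrightarrow> - a) (nhds a)"
    by (rule tendsto_fpsI)
qed

text \<open>A coefficient of a product involves all lower coefficients of the factors, hence the
  strong form of eventual agreement.\<close>

instance fps :: (comm_ring_1) topological_comm_monoid_mult
proof
  fix a b :: "'a fps"
  have "\<forall>\<^sub>F x in nhds a \<times>\<^sub>F nhds b. fps_nth (fst x * snd x) n = fps_nth (a * b) n" for n
    using eventually_prodI[OF eventually_fps_nth_eq_nhds_fps_strong[of n a] eventually_fps_nth_eq_nhds_fps_strong[of n b]]
    by eventually_elim (auto simp: fps_mult_nth intro!: sum.cong)
  then show "LIM x (nhds a \<times>\<^sub>F nhds b). fst x * snd x :> nhds (a * b)"
    by (rule tendsto_fpsI)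
qed

text \<open>The series \<open>x ^ m\<close> has order at least \<open>m\<close>. Divisibility by
  powers of \<open>x\<close> thus serves as the error estimate in the convergence proofs.\<close>

lemma fps_nth_eq_0_if_power_dvd:
  fixes x f :: "'a :: comm_ring_1 fps"
  assumes "fps_nth x 0 = 0" "x ^ m dvd f" "n < m"
  shows "fps_nth f n = 0"
proof -
  obtain g where g: "f = x ^ m * g"
    using assms(2) by (rule dvdE)
  have "fps_nth (x ^ m) i = 0" if "i < m" for i
    using startsby_zero_power_prefix[OF assms(1), of m] that by blast
  then show ?thesis
    unfolding g fps_mult_nth using assms(3) by (intro sum.neutral) auto
qed

lemma fps_LIMSEQ_if_power_dvd:
  fixes x L :: "'a :: comm_ring_1 fps"
  assumes "fps_nth x 0 = 0" "\<And>m. x ^ m dvd S m - L"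
  shows "S \<longlonglongrightarrow> L"
proof (rule tendsto_fpsI)
  fix n
  show "\<forall>\<^sub>F m in sequentially. fps_nth (S m) n = fps_nth L n"
    using eventually_gt_at_top[of n]
  proof eventually_elim
    case (elim m)
    with fps_nth_eq_0_if_power_dvd[OF assms(1) assms(2)[of m]] show ?case by simp
  qed
qed

text \<open>Coefficient \<open>n\<close> is frozen from index \<open>Suc n\<close> on, which gives
  the limit explicitly.\<close>

lemma fps_convergent_if_power_dvd:
  fixes x :: "'a :: comm_ring_1 fps"
  assumes "fps_nth x 0 = 0" "\<And>m. x ^ m dvd S (Suc m) - S m"
  shows "convergent S"
proof -
  have stable: "fps_nth (S m) n = fps_nth (S (Suc n)) n" if "m > n" for m n
    using Suc_leI[OF that]
  proof (induction m rule: dec_induct)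
    case (step k)
    with fps_nth_eq_0_if_power_dvd[OF assms(1) assms(2)[of k], of n] show ?case by simp
  qed auto
  have "S \<longlonglongrightarrow> Abs_fps (\<lambda>n. fps_nth (S (Suc n)) n)"
  proof (rule tendsto_fpsI)
    fix n
    show "\<forall>\<^sub>F m in sequentially. fps_nth (S m) n = fps_nth (Abs_fps (\<lambda>n. fps_nth (S (Suc n)) n)) n"
      using eventually_gt_at_top[of n] by eventually_elim (simp, rule stable)
  qed
  then show ?thesis by (rule convergentI)
qed

text \<open>Carries an identity of finite products or sums over to the limits; most infinite
  identities below arise this way.\<close>

lemma LIMSEQ_eqI:
  fixes a b :: "'a :: t2_space"
  assumes "\<And>m. S m = T m" "S \<longlonglongrightarrow> a" "T \<longlonglongrightarrow> b"
  shows "a = b"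
proof -
  have "S = T" using assms(1) by (rule ext)
  with assms(2,3) show ?thesis by (auto intro: LIMSEQ_unique)
qed

subsection \<open>Euler products and the Jacobi triple product\<close>

text \<open>The q-Pochhammer symbol (x; x)_m. An arbitrary series as base lets -q and powers of q be
  substituted directly.\<close>

definition qpoch :: "'a :: comm_ring_1 fps \<Rightarrow> nat \<Rightarrow> 'a fps" where
  "qpoch x m = (\<Prod>k<m. 1 - x ^ Suc k)"

definition euler :: "'a :: comm_ring_1 fps \<Rightarrow> 'a fps" where
  "euler x = lim (qpoch x)"

lemma qpoch_0 [simp]: "qpoch x 0 = 1"
  by (simp add: qpoch_def)

lemma qpoch_Suc: "qpoch x (Suc m) = qpoch x m * (1 - x ^ Suc m)"
  by (simp add: qpoch_def)

lemma qpoch_nth_0: "fps_nth x 0 = 0 \<Longrightarrow> fps_nth (qpoch x m) 0 = 1"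
  by (induction m) (auto simp: qpoch_Suc fps_power_zeroth)

lemma qpoch_diff_dvd: "m \<le> n \<Longrightarrow> x ^ Suc m dvd qpoch x n - qpoch x m"
proof (induction n rule: dec_induct)
  case (step n)
  have "qpoch x (Suc n) - qpoch x m = (qpoch x n - qpoch x m) - qpoch x n * x ^ Suc n"
    by (simp add: qpoch_Suc algebra_simps)
  moreover have "x ^ Suc m dvd qpoch x n * x ^ Suc n"
    using step by (intro dvd_mult le_imp_power_dvd) auto
  ultimately show ?case
    using step by (metis dvd_diff)
qed auto

lemma qpoch_LIMSEQ:
  assumes "fps_nth x 0 = 0"
  shows "qpoch x \<longlonglongrightarrow> euler x"
proof -
  have "x ^ m dvd qpoch x (Suc m) - qpoch x m" for m
    using qpoch_diff_dvd[of m "Suc m" x] by (rule dvd_trans[OF le_imp_power_dvd, rotated]) auto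
  then show ?thesis
    unfolding euler_def using fps_convergent_if_power_dvd[OF assms] convergent_LIMSEQ_iff by blast
qed

lemma euler_nth_0:
  assumes "fps_nth x 0 = 0"
  shows "fps_nth (euler x) 0 = 1"
proof -
  have "\<forall>\<^sub>F m in sequentially. fps_nth (qpoch x m) 0 = fps_nth (euler x) 0"
    using qpoch_LIMSEQ[OF assms] unfolding tendsto_fps_iff by blast
  then have "\<exists>m. fps_nth (qpoch x m) 0 = fps_nth (euler x) 0"
    by (auto simp: eventually_sequentially)
  then show ?thesis
    by (auto simp: qpoch_nth_0[OF assms])
qed

lemma euler_nonzero: "fps_nth x 0 = 0 \<Longrightarrow> euler x \<noteq> 0"
  using euler_nth_0[of x] by auto

section \<open>Gaussian binomial coefficients\<close>

fun qbinom :: "'a :: comm_ring_1 \<Rightarrow> nat \<Rightarrow> nat \<Rightarrow> 'a" where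
  "qbinom x n 0 = 1"
| "qbinom x 0 (Suc k) = 0"
| "qbinom x (Suc n) (Suc k) = qbinom x n k + x ^ Suc k * qbinom x n (Suc k)"

lemma qbinom_eq_0: "n < k \<Longrightarrow> qbinom x n k = 0"
  by (induction x n k rule: qbinom.induct) auto

lemma qbinom_self: "qbinom x n n = 1"
  by (induction n) (auto simp: qbinom_eq_0)

text \<open>The mirror image of the defining q-Pascal rule. In the finite triple product, the
  induction on \<open>s\<close> uses the defining rule and the induction on \<open>r\<close> uses
  this one.\<close>

lemma qbinom_Suc_Suc':
  "k \<le> n \<Longrightarrow> qbinom x (Suc n) (Suc k) = x ^ (n - k) * qbinom x n k + qbinom x n (Suc k)"
proof (induction n arbitrary: k)
  case (Suc n)
  show ?case
  proof (cases k)
    case 0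
    with Suc.IH[of 0] show ?thesis by (simp add: algebra_simps)
  next
    case (Suc j)
    show ?thesis
    proof (cases "k \<le> n")
      case True
      with Suc have "j \<le> n" "n - j = Suc (n - Suc j)" by auto
      have "qbinom x (Suc (Suc n)) (Suc k) = qbinom x (Suc n) k + x ^ Suc k * qbinom x (Suc n) (Suc k)"
        by simp
      also have "qbinom x (Suc n) k = x ^ (n - j) * qbinom x n j + qbinom x n (Suc j)"
        using Suc.IH[of j] \<open>j \<le> n\<close> Suc by simp
      also have "qbinom x (Suc n) (Suc k) = x ^ (n - k) * qbinom x n k + qbinom x n (Suc k)"
        using Suc.IH[of k] True by simp
      finally show ?thesis
        using Suc True \<open>n - j = Suc (n - Suc j)\<close> by (simp add: algebra_simps)
    next
      case False
      with Suc.prems have "k = Suc n" by simp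
      then show ?thesis by (simp add: qbinom_eq_0 qbinom_self del: qbinom.simps)
    qed
  qed
qed auto

text \<open>The quotient formula for Gaussian binomials in division-free form.\<close>

lemma qbinom_qpoch:
  "k \<le> n \<Longrightarrow> qbinom x n k * qpoch x k * qpoch x (n - k) = qpoch x n"
proof (induction n arbitrary: k)
  case (Suc n)
  show ?case
  proof (cases k)
    case (Suc j)
    show ?thesis
    proof (cases "k \<le> n")
      case True
      with Suc have j: "j \<le> n" "n - j = Suc (n - k)" "Suc n = Suc j + Suc (n - k)"
        by auto
      have "qbinom x (Suc n) k * qpoch x k * qpoch x (Suc n - k) =
        (qbinom x n j * qpoch x j * qpoch x (n - j)) * (1 - x ^ Suc j) +
        (qbinom x n k * qpoch x k * qpoch x (n - k)) * x ^ Suc j * (1 - x ^ Suc (n - k))"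
        using Suc True j by (simp add: qpoch_Suc Suc_diff_le algebra_simps)
      also have "\<dots> = qpoch x n * (1 - x ^ Suc j) + qpoch x n * x ^ Suc j * (1 - x ^ Suc (n - k))"
        using Suc.IH[of j] Suc.IH[of k] j True by simp
      also have "\<dots> = qpoch x n * (1 - x ^ (Suc j + Suc (n - k)))"
        by (simp only: power_add) (simp add: algebra_simps)
      also have "\<dots> = qpoch x (Suc n)"
        unfolding qpoch_Suc j(3)[symmetric] ..
      finally show ?thesis .
    next
      case False
      with Suc.prems have "k = Suc n" by simp
      then show ?thesis by (simp add: qbinom_self del: qbinom.simps)
    qed
  qed auto
qed auto

section \<open>Triangular numbers and the terms of theta series\<close>

definition tri :: "int \<Rightarrow> nat" where
  "tri j = nat (j * (j + 1) div 2)"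

text \<open>The factors \<open>j\<close> and \<open>j + 1\<close> never have opposite signs and one
  of them is even, so neither \<open>nat\<close> nor \<open>div\<close> loses anything.\<close>

lemma two_tri: "2 * int (tri j) = j * (j + 1)"
proof -
  have "j * (j + 1) \<ge> 0"
    by (cases "j \<ge> 0") (auto simp: zero_le_mult_iff)
  moreover have "even (j * (j + 1))" by simp
  ultimately show ?thesis
    unfolding tri_def by auto
qed

lemma tri_eqI: "2 * int n = j * (j + 1) \<Longrightarrow> tri j = n"
  using two_tri[of j] by linarith

lemma tri_minus: "tri (- j) = tri (j - 1)"
  by (rule tri_eqI) (simp add: two_tri algebra_simps)

lemma int_tri_add_1: "int (tri (j + 1)) = int (tri j) + j + 1"
  using two_tri[of j] two_tri[of "j + 1"] by (simp add: algebra_simps)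

lemma le_tri: "j \<le> int (tri j)"
proof (cases "j \<le> 0")
  case False
  then have "0 \<le> j * (j - 1)" by simp
  with two_tri[of j] show ?thesis by (simp add: algebra_simps)
qed simp

text \<open>With q = ab this is q^(j(j-1)/2) a^j, written with two nonnegative exponents so that
  negative \<open>j\<close> needs no inverse.\<close>

definition theta_term :: "'a :: comm_ring_1 \<Rightarrow> 'a \<Rightarrow> int \<Rightarrow> 'a" where
  "theta_term a b j = a ^ tri j * b ^ tri (j - 1)"

text \<open>The effect of a new factor 1 + a q^m with q = ab: its second summand moves the term to
  the next index, up to a power of q.\<close>

lemma theta_term_succ:
  assumes "j \<le> int m"
  shows "theta_term a b j * (a * (a * b) ^ m) = theta_term a b (j + 1) * (a * b) ^ nat (int m - j)"
proof -
  have "tri j + Suc m = tri (j + 1) + nat (int m - j)"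
    using int_tri_add_1[of j] assms by linarith
  moreover have "tri (j - 1) + m = tri j + nat (int m - j)"
    using int_tri_add_1[of "j - 1"] assms by simp
  moreover have "theta_term a b j * (a * (a * b) ^ m) = a ^ (tri j + Suc m) * b ^ (tri (j - 1) + m)"
    by (simp add: theta_term_def power_mult_distrib power_add algebra_simps)
  ultimately show ?thesis
    by (simp add: theta_term_def power_mult_distrib power_add algebra_simps)
qed

lemma theta_term_commute: "theta_term a b j = theta_term b a (- j)"
  using tri_minus[of j] tri_minus[of "j + 1"] by (simp add: theta_term_def mult.commute)

lemma theta_term_pred:
  assumes "- j \<le> int m"
  shows "theta_term a b j * (b * (a * b) ^ m) = theta_term a b (j - 1) * (a * b) ^ nat (int m + j)"
  using theta_term_succ[of "- j" m b a] assms
  by (simp add: theta_term_commute[of a b] mult.commute[of b a])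

text \<open>For \<open>j > m\<close> both exponents are at least \<open>j - 1\<close>, hence at
  least \<open>m\<close>; negative \<open>j\<close> follows by swapping \<open>a\<close> and
  \<open>b\<close>.\<close>

lemma theta_term_dvd:
  assumes "m < nat \<bar>j\<bar>"
  shows "(a * b) ^ m dvd theta_term a b j"
proof -
  have *: "(a * b) ^ m dvd theta_term a b j" if "int m < j" for j and a b :: 'a
  proof -
    have "m \<le> tri j" "m \<le> tri (j - 1)"
      using that le_tri[of j] le_tri[of "j - 1"] by linarith+
    then show ?thesis
      unfolding theta_term_def power_mult_distrib by (intro mult_dvd_mono le_imp_power_dvd)
  qed
  show ?thesis
  proof (cases "j \<ge> 0")
    case True
    with assms * show ?thesis by simp
  next
    case False
    with assms *[of "- j" b a] show ?thesis
      by (simp add: theta_term_commute[of a b] mult.commute[of b a])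
  qed
qed

text \<open>A symmetric q-binomial theorem. Each new factor splits the sum in two; after an index
  shift a q-Pascal rule merges the two again.\<close>

theorem finite_jacobi_triple_product:
  "(\<Prod>k<r. 1 + a * (a * b) ^ k) * (\<Prod>k<s. 1 + b * (a * b) ^ k) =
    (\<Sum>k\<le>r + s. qbinom (a * b) (r + s) k * theta_term a b (int k - int s))"
proof (induction r)
  case 0
  show ?case
  proof (induction s)
    case 0
    show ?case by (simp add: theta_term_def tri_def)
  next
    case (Suc s)
    let ?q = "a * b" and ?T = "\<lambda>k. theta_term a b (int k - int s)"
      and ?T' = "\<lambda>k. theta_term a b (int k - int (Suc s))"
    have "(\<Prod>k<0. 1 + a * ?q ^ k) * (\<Prod>k<Suc s. 1 + b * ?q ^ k) =
      (\<Sum>k\<le>s. qbinom ?q s k * ?T k) + (\<Sum>k\<le>s. qbinom ?q s k * (?T k * (b * ?q ^ s)))"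
      using Suc.IH by (simp add: algebra_simps sum.distrib sum_distrib_left)
    also have "(\<Sum>k\<le>s. qbinom ?q s k * (?T k * (b * ?q ^ s))) = (\<Sum>k\<le>s. ?q ^ k * qbinom ?q s k * ?T' k)"
    proof (rule sum.cong)
      fix k assume "k \<in> {..s}"
      then show "qbinom ?q s k * (?T k * (b * ?q ^ s)) = ?q ^ k * qbinom ?q s k * ?T' k"
        using theta_term_pred[of "int k - int s" s a b] by (simp add: algebra_simps)
    qed auto
    also have "\<dots> = (\<Sum>k\<le>Suc s. ?q ^ k * qbinom ?q s k * ?T' k)"
      by (simp add: qbinom_eq_0)
    also have "\<dots> = ?T' 0 + (\<Sum>k\<le>s. ?q ^ Suc k * qbinom ?q s (Suc k) * ?T' (Suc k))"
      by (subst sum.atMost_Suc_shift) simp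
    \<comment> \<open>Raising \<open>s\<close> shifts the indices: \<open>?T k\<close> is
      \<open>?T' (Suc k)\<close>, so the defining recurrence of \<open>qbinom\<close> applies
      termwise.\<close>
    also have "(\<Sum>k\<le>s. qbinom ?q s k * ?T k) + \<dots> =
      ?T' 0 + (\<Sum>k\<le>s. qbinom ?q (Suc s) (Suc k) * ?T' (Suc k))"
      by (simp add: sum.distrib algebra_simps)
    also have "\<dots> = (\<Sum>k\<le>Suc s. qbinom ?q (Suc s) k * ?T' k)"
      by (subst sum.atMost_Suc_shift) simp
    finally show ?case by simp
  qed
next
  case (Suc r)
  let ?q = "a * b" and ?T = "\<lambda>k. theta_term a b (int k - int s)" and ?n = "r + s"
  have "(\<Prod>k<Suc r. 1 + a * ?q ^ k) * (\<Prod>k<s. 1 + b * ?q ^ k) =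
    (\<Sum>k\<le>?n. qbinom ?q ?n k * ?T k) * (1 + a * ?q ^ r)"
    by (simp flip: Suc.IH add: algebra_simps)
  also have "\<dots> = (\<Sum>k\<le>?n. qbinom ?q ?n k * ?T k) + (\<Sum>k\<le>?n. qbinom ?q ?n k * (?T k * (a * ?q ^ r)))"
    by (simp add: algebra_simps sum.distrib sum_distrib_left)
  also have "(\<Sum>k\<le>?n. qbinom ?q ?n k * (?T k * (a * ?q ^ r))) =
    (\<Sum>k\<le>?n. ?q ^ (?n - k) * qbinom ?q ?n k * ?T (Suc k))"
  proof (rule sum.cong)
    fix k assume "k \<in> {..?n}"
    then have "int k - int s \<le> int r" "nat (int r - (int k - int s)) = ?n - k"
      by auto
    then show "qbinom ?q ?n k * (?T k * (a * ?q ^ r)) = ?q ^ (?n - k) * qbinom ?q ?n k * ?T (Suc k)"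
      using theta_term_succ[of "int k - int s" r a b] by (simp add: algebra_simps)
  qed auto
  also have "(\<Sum>k\<le>?n. qbinom ?q ?n k * ?T k) = (\<Sum>k\<le>Suc ?n. qbinom ?q ?n k * ?T k)"
    by (simp add: qbinom_eq_0)
  also have "\<dots> = ?T 0 + (\<Sum>k\<le>?n. qbinom ?q ?n (Suc k) * ?T (Suc k))"
    by (subst sum.atMost_Suc_shift) simp
  also have "\<dots> + (\<Sum>k\<le>?n. ?q ^ (?n - k) * qbinom ?q ?n k * ?T (Suc k)) =
    ?T 0 + (\<Sum>k\<le>?n. qbinom ?q (Suc ?n) (Suc k) * ?T (Suc k))"
    by (simp add: qbinom_Suc_Suc' sum.distrib algebra_simps del: qbinom.simps)
  also have "\<dots> = (\<Sum>k\<le>Suc ?n. qbinom ?q (Suc ?n) k * ?T k)"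
    by (subst sum.atMost_Suc_shift) simp
  finally show ?case by simp
qed

text \<open>Partial sums of Ramanujan's general theta function \<open>f(a, b) = \<Sum> a\<^bsup>j(j+1)/2\<^esup> b\<^bsup>j(j-1)/2\<^esup>\<close>.\<close>
definition theta_sum :: "'a :: comm_ring_1 \<Rightarrow> 'a \<Rightarrow> nat \<Rightarrow> 'a" where
  "theta_sum a b m = (\<Sum>j\<in>{- int m..int m}. theta_term a b j)"

definition theta :: "'a :: comm_ring_1 fps \<Rightarrow> 'a fps \<Rightarrow> 'a fps" where
  "theta a b = lim (theta_sum a b)"

lemma theta_sum_LIMSEQ:
  assumes "fps_nth (a * b) 0 = 0"
  shows "theta_sum a b \<longlonglongrightarrow> theta a b"
proof -
  have "(a * b) ^ m dvd theta_sum a b (Suc m) - theta_sum a b m" for m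
  proof -
    have "{- int (Suc m)..int (Suc m)} = insert (int (Suc m)) (insert (- int (Suc m)) {- int m..int m})"
      by auto
    then have "theta_sum a b (Suc m) - theta_sum a b m =
        theta_term a b (int (Suc m)) + theta_term a b (- int (Suc m))"
      by (simp add: theta_sum_def)
    then show ?thesis
      by (auto intro!: dvd_add theta_term_dvd)
  qed
  then show ?thesis
    unfolding theta_def using fps_convergent_if_power_dvd[OF assms] convergent_LIMSEQ_iff by blast
qed

text \<open>All q-Pochhammer symbols involved have index at least \<open>r\<close>, so modulo
  \<open>x ^ Suc r\<close> they equal \<open>e = qpoch x r\<close>. The quotient formula then reads
  \<open>?B * e * e = e\<close>, and \<open>e\<close> is a unit.\<close>

lemma qbinom_central_dvd:
  fixes x :: "'a :: field fps"
  assumes "fps_nth x 0 = 0" "r \<le> k" "k + r \<le> n" "r \<le> l"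
  shows "x ^ Suc r dvd qbinom x n k * qpoch x l - 1"
proof -
  define e where "e = qpoch x r"
  define y where "y = x ^ Suc r"
  have nk: "r \<le> n - k" using assms by linarith
  have *: "\<exists>A. qpoch x i = e + y * A" if "r \<le> i" for i
  proof -
    from qpoch_diff_dvd[OF that, of x] obtain A where "qpoch x i - e = y * A"
      unfolding e_def y_def by (rule dvdE)
    then show ?thesis by (auto simp: diff_eq_eq add.commute)
  qed
  obtain A where A: "qpoch x k = e + y * A"
    using *[of k] assms by blast
  obtain B where B: "qpoch x (n - k) = e + y * B"
    using *[OF nk] by blast
  obtain C where C: "qpoch x n = e + y * C"
    using *[of n] assms by (meson add_leD2)
  obtain D where D: "qpoch x l = e + y * D"
    using *[of l] assms by blast
  note ABCD = A B C D
  let ?B = "qbinom x n k"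
  have "?B * (e + y * A) * (e + y * B) = e + y * C"
    using qbinom_qpoch[of k n x] assms unfolding ABCD by simp
  then have "e * (?B * qpoch x l - 1) = y * (C - ?B * A * e - ?B * e * B - ?B * y * A * B + e * ?B * D)"
    unfolding ABCD by (simp add: algebra_simps)
  then have "y dvd e * (?B * qpoch x l - 1)" by simp
  moreover have "e dvd 1"
    by (simp add: e_def qpoch_nth_0[OF assms(1)])
  ultimately show ?thesis
    unfolding y_def by (metis dvd_mult_unit_iff' dvd_trans mult.commute one_dvd)
qed

text \<open>The finite form with r = s = m. Compared with \<open>theta_sum\<close>, central terms
  differ little because the q-binomial is nearly the inverse of \<open>qpoch\<close>, outer terms
  because \<open>theta_term\<close> itself is small.\<close>

theorem jacobi_triple_product:
  fixes a b :: "'a :: field fps"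
  assumes "fps_nth (a * b) 0 = 0"
  shows "(\<lambda>m. (\<Prod>k<m. (1 + a * (a * b) ^ k) * (1 + b * (a * b) ^ k)) * qpoch (a * b) m) \<longlonglongrightarrow> theta a b"
proof -
  let ?q = "a * b"
  let ?S = "\<lambda>m. (\<Prod>k<m. (1 + a * ?q ^ k) * (1 + b * ?q ^ k)) * qpoch ?q m"
  have "?q ^ m dvd (?S m - theta_sum a b m) - 0" for m
  proof -
    have "?S m = (\<Sum>k\<le>m + m. qbinom ?q (m + m) k * theta_term a b (int k - int m)) * qpoch ?q m"
      by (subst finite_jacobi_triple_product[symmetric]) (simp add: prod.distrib)
    also have "(\<Sum>k\<le>m + m. qbinom ?q (m + m) k * theta_term a b (int k - int m)) =
      (\<Sum>j\<in>{- int m..int m}. qbinom ?q (m + m) (nat (j + int m)) * theta_term a b j)"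
      by (rule sum.reindex_bij_witness[of _ "\<lambda>j. nat (j + int m)" "\<lambda>k. int k - int m"]) auto
    finally have "?S m - theta_sum a b m =
      (\<Sum>j\<in>{- int m..int m}. theta_term a b j * (qbinom ?q (m + m) (nat (j + int m)) * qpoch ?q m - 1))"
      by (simp only: theta_sum_def sum_distrib_right flip: sum_subtractf) (auto intro!: sum.cong simp: algebra_simps)
    moreover have "?q ^ m dvd theta_term a b j * (qbinom ?q (m + m) (nat (j + int m)) * qpoch ?q m - 1)"
      if j: "j \<in> {- int m..int m}" for j
    proof -
      \<comment> \<open>The two orders |j| - 1 and r + 1 add up to m. For j = 0 truncated
        subtraction makes the first one 0, which suffices as well.\<close>
      define r where "r = m - nat \<bar>j\<bar>"
      have "?q ^ Suc r dvd qbinom ?q (m + m) (nat (j + int m)) * qpoch ?q m - 1"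
        using j by (intro qbinom_central_dvd[OF assms]) (auto simp: r_def)
      moreover have "?q ^ (nat \<bar>j\<bar> - 1) dvd theta_term a b j"
        by (cases "j = 0") (auto intro!: theta_term_dvd)
      ultimately have "?q ^ (nat \<bar>j\<bar> - 1) * ?q ^ Suc r dvd
          theta_term a b j * (qbinom ?q (m + m) (nat (j + int m)) * qpoch ?q m - 1)"
        by (intro mult_dvd_mono)
      moreover have "?q ^ m dvd ?q ^ (nat \<bar>j\<bar> - 1) * ?q ^ Suc r"
        unfolding power_add[symmetric] r_def using j by (intro le_imp_power_dvd) auto
      ultimately show ?thesis by (rule dvd_trans[rotated])
    qed
    ultimately show ?thesis by (auto intro!: dvd_sum)
  qed
  then have "(\<lambda>m. ?S m - theta_sum a b m) \<longlonglongrightarrow> 0"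
    by (rule fps_LIMSEQ_if_power_dvd[OF assms])
  from tendsto_add[OF this theta_sum_LIMSEQ[OF assms]] show ?thesis by simp
qed

subsection \<open>Special theta functions and their dissections\<close>

lemma prod_plus_qpoch: "(\<Prod>k<m. 1 + x ^ Suc k) * qpoch x m = qpoch (x ^ 2) m"
proof (induction m)
  case (Suc m)
  define y where "y = x ^ Suc m"
  have y2: "(x ^ 2) ^ Suc m = y ^ 2"
    by (simp only: y_def mult.commute flip: power_mult)
  have "(\<Prod>k<Suc m. 1 + x ^ Suc k) * qpoch x (Suc m) =
    ((\<Prod>k<m. 1 + x ^ Suc k) * qpoch x m) * ((1 + y) * (1 - y))"
    unfolding prod.lessThan_Suc qpoch_Suc y_def[symmetric] by (simp only: mult_ac)
  also have "(1 + y) * (1 - y) = 1 - y ^ 2"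
    by (simp add: algebra_simps power2_eq_square)
  finally show ?case
    by (simp only: Suc.IH qpoch_Suc y2)
qed auto

lemma qpoch_LIMSEQ_mult:
  assumes "fps_nth x 0 = 0" "c > 0"
  shows "(\<lambda>m. qpoch x (c * m)) \<longlonglongrightarrow> euler x"
  using LIMSEQ_subseq_LIMSEQ[OF qpoch_LIMSEQ[OF assms(1)], of "\<lambda>m. c * m"] assms(2)
  by (simp add: strict_mono_def o_def)

text \<open>For a = b = -x the triple product contains the odd factors 1 - x^(2k+1) twice and the
  even ones once; a second \<open>euler (x ^ 2)\<close> completes the square.\<close>

lemma theta_phi_product:
  fixes x :: "'a :: field fps"
  assumes "fps_nth x 0 = 0"
  shows "theta (- x) (- x) * euler (x ^ 2) = euler x ^ 2"
proof -
  let ?S = "\<lambda>m. (\<Prod>k<m. (1 + - x * (- x * - x) ^ k) * (1 + - x * (- x * - x) ^ k)) * qpoch (- x * - x) m"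
  have x2: "- x * - x = x ^ 2" by (simp add: power2_eq_square)
  have "?S m * qpoch (x ^ 2) m = qpoch x (2 * m) ^ 2" for m
    unfolding x2
  proof (induction m)
    case (Suc m)
    define u where "u = 1 + - x * (x ^ 2) ^ m"
    define v where "v = 1 - (x ^ 2) ^ Suc m"
    have "x ^ Suc (2 * m) = x * (x ^ 2) ^ m" "x ^ Suc (Suc (2 * m)) = (x ^ 2) ^ Suc m"
      by (simp_all only: power_Suc power_mult) (simp add: power2_eq_square mult.assoc)
    then have "qpoch x (2 * Suc m) = qpoch x (2 * m) * u * v"
      by (simp add: qpoch_Suc u_def v_def del: power_Suc)
    then have "qpoch x (2 * Suc m) ^ 2 = qpoch x (2 * m) ^ 2 * (u ^ 2 * v ^ 2)"
      by (simp add: power_mult_distrib)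
    then show ?case
      unfolding Suc.IH[symmetric] prod.lessThan_Suc qpoch_Suc u_def[symmetric] v_def[symmetric]
      by (simp only: power2_eq_square[of u] power2_eq_square[of v] mult_ac)
  qed auto
  moreover have "(\<lambda>m. ?S m * qpoch (x ^ 2) m) \<longlonglongrightarrow> theta (- x) (- x) * euler (x ^ 2)"
    using assms by (intro tendsto_mult jacobi_triple_product qpoch_LIMSEQ) (auto simp: power2_eq_square)
  moreover have "(\<lambda>m. qpoch x (2 * m) ^ 2) \<longlonglongrightarrow> euler x ^ 2"
    using assms by (intro tendsto_power_strong tendsto_const qpoch_LIMSEQ_mult) auto
  ultimately show ?thesis
    by (rule LIMSEQ_eqI)
qed

text \<open>The bilateral sum \<open>theta x 1\<close> meets every triangular number twice, so it is \<open>2 \<psi>(x)\<close>, that is \<open>-\<psi>(x)\<close> modulo 3.\<close>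
lemma theta_psi_product:
  fixes x :: "'a :: field fps"
  assumes "fps_nth x 0 = 0"
  shows "theta x 1 * euler x = 2 * euler (x ^ 2) ^ 2"
proof -
  let ?S = "\<lambda>m. (\<Prod>k<m. (1 + x * (x * 1) ^ k) * (1 + 1 * (x * 1) ^ k)) * qpoch (x * 1) m"
  \<comment> \<open>The extra factor, which tends to 1, completes the second product to
    \<open>k = m\<close>; its factor for \<open>k = 0\<close> is the 2.\<close>
  have "?S m * (1 + x ^ m) * qpoch x m = 2 * qpoch (x ^ 2) m ^ 2" for m
  proof -
    have "(\<Prod>k<m. 1 + x ^ k) * (1 + x ^ m) = (\<Prod>k<Suc m. 1 + x ^ k)"
      by simp
    also have "\<dots> = 2 * (\<Prod>k<m. 1 + x ^ Suc k)"
      by (subst prod.lessThan_Suc_shift) simp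
    finally have "(\<Prod>k<m. 1 + x ^ k) * (1 + x ^ m) = 2 * (\<Prod>k<m. 1 + x ^ Suc k)" .
    moreover have "?S m = (\<Prod>k<m. 1 + x ^ Suc k) * (\<Prod>k<m. 1 + x ^ k) * qpoch x m"
      by (simp add: prod.distrib)
    then have "?S m * (1 + x ^ m) * qpoch x m = ((\<Prod>k<m. 1 + x ^ k) * (1 + x ^ m)) *
        ((\<Prod>k<m. 1 + x ^ Suc k) * qpoch x m * qpoch x m)"
      by (simp only: mult_ac)
    ultimately have "?S m * (1 + x ^ m) * qpoch x m =
      2 * ((\<Prod>k<m. 1 + x ^ Suc k) * qpoch x m) * ((\<Prod>k<m. 1 + x ^ Suc k) * qpoch x m)"
      by (simp only: mult_ac)
    then show ?thesis
      by (simp only: prod_plus_qpoch power2_eq_square mult.assoc)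
  qed
  moreover have "(\<lambda>m. ?S m * (1 + x ^ m) * qpoch x m) \<longlonglongrightarrow> theta x 1 * (1 + 0) * euler x"
    using assms fps_LIMSEQ_if_power_dvd[OF assms, of "\<lambda>m. x ^ m" 0]
    by (intro tendsto_mult jacobi_triple_product qpoch_LIMSEQ tendsto_add tendsto_const) auto
  moreover have "(\<lambda>m. 2 * qpoch (x ^ 2) m ^ 2) \<longlonglongrightarrow> 2 * euler (x ^ 2) ^ 2"
    using assms by (intro tendsto_mult tendsto_power_strong tendsto_const qpoch_LIMSEQ) auto
  ultimately have "theta x 1 * (1 + 0) * euler x = 2 * euler (x ^ 2) ^ 2"
    by (rule LIMSEQ_eqI)
  then show ?thesis by simp
qed

text \<open>The triple product with q = x^3 runs over 1 + x^j for j not divisible by 3. Adjoining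
  the multiples of 3 gives full products, which \<open>prod_plus_qpoch\<close> evaluates.\<close>

lemma theta_cubic_product:
  fixes x :: "'a :: field fps"
  assumes "fps_nth x 0 = 0"
  shows "theta (x ^ 2) x * euler (x ^ 6) * euler x = euler (x ^ 2) * euler (x ^ 3) ^ 2"
proof -
  let ?S = "\<lambda>m. (\<Prod>k<m. (1 + x ^ 2 * (x ^ 2 * x) ^ k) * (1 + x * (x ^ 2 * x) ^ k)) * qpoch (x ^ 2 * x) m"
  have x3: "x ^ 2 * x = x ^ 3" by (simp add: eval_nat_numeral)
  have "?S m * qpoch (x ^ 6) m * qpoch x (3 * m) = qpoch (x ^ 2) (3 * m) * qpoch (x ^ 3) m ^ 2" for m
  proof -
    have "(\<Prod>k<m. (1 + x ^ 2 * (x ^ 3) ^ k) * (1 + x * (x ^ 3) ^ k)) * (\<Prod>k<m. 1 + (x ^ 3) ^ Suc k) =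
      (\<Prod>k<3 * m. 1 + x ^ Suc k)"
    proof (induction m)
      case (Suc m)
      have three: "3 * Suc m = Suc (Suc (Suc (3 * m)))" by simp
      define u where "u = 1 + x * (x ^ 3) ^ m"
      define v where "v = 1 + x ^ 2 * (x ^ 3) ^ m"
      define w where "w = 1 + (x ^ 3) ^ Suc m"
      have "x ^ Suc (3 * m) = x * (x ^ 3) ^ m" "x ^ Suc (Suc (3 * m)) = x ^ 2 * (x ^ 3) ^ m"
        "x ^ Suc (Suc (Suc (3 * m))) = (x ^ 3) ^ Suc m"
        by (simp_all only: power_Suc power_mult) (simp_all add: eval_nat_numeral mult.assoc)
      then have "(\<Prod>k<3 * Suc m. 1 + x ^ Suc k) = (\<Prod>k<3 * m. 1 + x ^ Suc k) * u * v * w"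
        by (simp only: three prod.lessThan_Suc u_def v_def w_def)
      then show ?case
        unfolding Suc.IH[symmetric] prod.lessThan_Suc u_def[symmetric] v_def[symmetric] w_def[symmetric]
        by (simp only: mult_ac)
    qed auto
    then have *: "(\<Prod>k<3 * m. 1 + x ^ Suc k) =
      (\<Prod>k<m. (1 + x ^ 2 * (x ^ 3) ^ k) * (1 + x * (x ^ 3) ^ k)) * (\<Prod>k<m. 1 + (x ^ 3) ^ Suc k)"
      by (rule sym)
    have x6: "x ^ 6 = (x ^ 3) ^ 2" by (simp flip: power_mult)
    show ?thesis
      unfolding x3 x6 prod_plus_qpoch[symmetric] * by (simp only: power2_eq_square mult_ac)
  qed
  moreover have "(\<lambda>m. ?S m * qpoch (x ^ 6) m * qpoch x (3 * m)) \<longlonglongrightarrow> theta (x ^ 2) x * euler (x ^ 6) * euler x"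
    using assms by (intro tendsto_mult jacobi_triple_product qpoch_LIMSEQ qpoch_LIMSEQ_mult) auto
  moreover have "(\<lambda>m. qpoch (x ^ 2) (3 * m) * qpoch (x ^ 3) m ^ 2) \<longlonglongrightarrow> euler (x ^ 2) * euler (x ^ 3) ^ 2"
    using assms by (intro tendsto_mult tendsto_power_strong tendsto_const qpoch_LIMSEQ qpoch_LIMSEQ_mult) auto
  ultimately show ?thesis
    by (rule LIMSEQ_eqI)
qed

text \<open>The even factors of \<open>euler x\<close> and \<open>euler (- x)\<close> coincide, and
  the odd ones pair to 1 - x^(2j) with j odd; \<open>euler (x ^ 4)\<close> supplies the even
  j.\<close>

lemma euler_uminus:
  assumes "fps_nth x 0 = 0"
  shows "euler x * euler (- x) * euler (x ^ 4) = euler (x ^ 2) ^ 3"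
proof -
  have "qpoch x (2 * m) * qpoch (- x) (2 * m) * qpoch (x ^ 4) m = qpoch (x ^ 2) (2 * m) * qpoch (x ^ 2) m ^ 2" for m
  proof (induction m)
    case (Suc m)
    define y where "y = x * (x ^ 2) ^ m"
    define z where "z = (x ^ 2) ^ Suc m"
    have e: "x ^ (2 * m) = (x ^ 2) ^ m" "(- x) ^ (2 * m) = (x ^ 2) ^ m"
      by (simp_all add: power_mult)
    have y2: "(x ^ 2) ^ Suc (2 * m) = y ^ 2"
      by (simp add: y_def power_mult_distrib power_mult mult.commute[of _ 2] del: power_Suc) (simp add: power_mult_distrib flip: power_mult)
    have z2: "(x ^ 2) ^ Suc (Suc (2 * m)) = z ^ 2" "(x ^ 4) ^ Suc m = z ^ 2"
      by (simp_all only: z_def flip: power_mult) (rule arg_cong[of _ _ "\<lambda>n. x ^ n"], simp)+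
    have "qpoch x (2 * Suc m) = qpoch x (2 * m) * (1 - y) * (1 - z)"
      by (simp add: y_def z_def qpoch_Suc e power2_eq_square mult.assoc)
    moreover have "qpoch (- x) (2 * Suc m) = qpoch (- x) (2 * m) * (1 + y) * (1 - z)"
      by (simp add: y_def z_def qpoch_Suc e power2_eq_square mult.assoc)
    moreover have "qpoch (x ^ 4) (Suc m) = qpoch (x ^ 4) m * (1 - z ^ 2)"
      by (simp add: qpoch_Suc z2 del: power_Suc)
    moreover have "qpoch (x ^ 2) (2 * Suc m) = qpoch (x ^ 2) (2 * m) * (1 - y ^ 2) * (1 - z ^ 2)"
      by (simp add: qpoch_Suc z2 y2 del: power_Suc)
    moreover have "qpoch (x ^ 2) (Suc m) = qpoch (x ^ 2) m * (1 - z)"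
      by (simp add: qpoch_Suc z_def)
    ultimately have "qpoch x (2 * Suc m) * qpoch (- x) (2 * Suc m) * qpoch (x ^ 4) (Suc m) =
      (qpoch x (2 * m) * qpoch (- x) (2 * m) * qpoch (x ^ 4) m) * ((1 - y) * (1 + y) * (1 - z ^ 2) * (1 - z) ^ 2)"
      by (simp only: power2_eq_square mult_ac)
    also have "(1 - y) * (1 + y) = 1 - y ^ 2"
      by (simp add: algebra_simps power2_eq_square)
    finally show ?case
      unfolding Suc.IH \<open>qpoch (x ^ 2) (2 * Suc m) = _\<close> \<open>qpoch (x ^ 2) (Suc m) = _\<close>
      by (simp only: power_mult_distrib mult_ac)
  qed auto
  moreover have "(\<lambda>m. qpoch x (2 * m) * qpoch (- x) (2 * m) * qpoch (x ^ 4) m) \<longlonglongrightarrow>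
    euler x * euler (- x) * euler (x ^ 4)"
    using assms by (intro tendsto_mult qpoch_LIMSEQ qpoch_LIMSEQ_mult) (auto simp: fps_power_zeroth)
  moreover have "(\<lambda>m. qpoch (x ^ 2) (2 * m) * qpoch (x ^ 2) m ^ 2) \<longlonglongrightarrow> euler (x ^ 2) * euler (x ^ 2) ^ 2"
    using assms by (intro tendsto_mult tendsto_power_strong tendsto_const qpoch_LIMSEQ qpoch_LIMSEQ_mult) (auto simp: fps_power_zeroth)
  ultimately have "euler x * euler (- x) * euler (x ^ 4) = euler (x ^ 2) * euler (x ^ 2) ^ 2"
    by (rule LIMSEQ_eqI)
  then show ?thesis
    by (simp add: power3_eq_cube power2_eq_square)
qed

section \<open>3-dissections of theta series\<close>

lemma sum_symmetric_mod_3: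
  fixes f :: "int \<Rightarrow> 'a :: comm_monoid_add"
  shows "(\<Sum>j\<in>{- int (3 * m + 1)..int (3 * m + 1)}. f j) =
    (\<Sum>i\<in>{- int m..int m}. f (3 * i)) + (\<Sum>i\<in>{- int m..int m}. f (3 * i - 1)) + (\<Sum>i\<in>{- int m..int m}. f (3 * i + 1))"
proof (induction m)
  case 0
  have "{- 1..1::int} = {0, - 1, 1}" by auto
  then show ?case by (simp add: add_ac)
next
  case (Suc m)
  let ?m = "int m"
  \<comment> \<open>The bound 3m + 1 keeps all three classes symmetric: each step adds six indices,
    two for each class.\<close>
  have "{- int (3 * Suc m + 1)..int (3 * Suc m + 1)} = insert (3 * ?m + 2) (insert (3 * ?m + 3) (insert (3 * ?m + 4)
    (insert (- 3 * ?m - 2) (insert (- 3 * ?m - 3) (insert (- 3 * ?m - 4) {- int (3 * m + 1)..int (3 * m + 1)})))))"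
    by auto
  then have "(\<Sum>j\<in>{- int (3 * Suc m + 1)..int (3 * Suc m + 1)}. f j) =
    f (3 * ?m + 2) + (f (3 * ?m + 3) + (f (3 * ?m + 4) + (f (- 3 * ?m - 2) + (f (- 3 * ?m - 3) + (f (- 3 * ?m - 4) +
    (\<Sum>j\<in>{- int (3 * m + 1)..int (3 * m + 1)}. f j))))))"
    by (simp only:) (subst sum.insert; simp)+
  moreover have "{- int (Suc m)..int (Suc m)} = insert (?m + 1) (insert (- ?m - 1) {- ?m..?m})"
    by auto
  then have "(\<Sum>i\<in>{- int (Suc m)..int (Suc m)}. g i) = g (?m + 1) + (g (- ?m - 1) + (\<Sum>i\<in>{- ?m..?m}. g i))"
    for g :: "int \<Rightarrow> 'a"
    by simp
  moreover have "3 * (?m + 1) = 3 * ?m + 3" "3 * (- ?m - 1) = - 3 * ?m - 3"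
    by simp_all
  moreover have "3 * ?m + 3 - 1 = 3 * ?m + 2" "- 3 * ?m - 3 - 1 = - 3 * ?m - 4"
    "3 * ?m + 3 + 1 = 3 * ?m + 4" "- 3 * ?m - 3 + 1 = - 3 * ?m - 2"
    by simp_all
  moreover note Suc.IH
  ultimately show ?case
    by (simp only: add_ac)
qed

lemma theta_sum_reflect: "theta_sum a b m = theta_sum b a m"
  unfolding theta_sum_def
  by (rule sum.reindex_bij_witness[of _ uminus uminus]) (auto simp: theta_term_commute[of a b])

lemma theta_sum_LIMSEQ_3:
  assumes "fps_nth (a * b) 0 = 0"
  shows "(\<lambda>m. theta_sum a b (3 * m + 1)) \<longlonglongrightarrow> theta a b"
  using LIMSEQ_subseq_LIMSEQ[OF theta_sum_LIMSEQ[OF assms], of "\<lambda>m. 3 * m + 1"]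
  by (simp add: strict_mono_def o_def)

text \<open>The indices 3i and 3i - 1 give two series that are reflections of each other; 3i + 1
  reproduces the original series in x^9.\<close>

lemma theta_psi_dissection:
  assumes "fps_nth x 0 = 0"
  shows "theta x 1 = 2 * theta (x ^ 6) (x ^ 3) + x * theta (x ^ 9) 1"
proof -
  have "theta_sum x 1 (3 * m + 1) = 2 * theta_sum (x ^ 6) (x ^ 3) m + x * theta_sum (x ^ 9) 1 m" for m
  proof -
    have "tri (3 * i) = 6 * tri i + 3 * tri (i - 1)" "tri (3 * i - 1) = 3 * tri i + 6 * tri (i - 1)"
      "tri (3 * i + 1) = Suc (9 * tri i)" for i
      using two_tri[of i] two_tri[of "i - 1"] by (auto intro!: tri_eqI simp: algebra_simps)
    then have "theta_sum x 1 (3 * m + 1) = theta_sum (x ^ 6) (x ^ 3) m + theta_sum (x ^ 3) (x ^ 6) m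
        + x * theta_sum (x ^ 9) 1 m"
      unfolding theta_sum_def sum_symmetric_mod_3 by (simp add: theta_term_def power_add power_mult sum_distrib_left)
    then show ?thesis
      by (simp add: theta_sum_reflect[of "x ^ 3"])
  qed
  moreover have "(\<lambda>m. theta_sum x 1 (3 * m + 1)) \<longlonglongrightarrow> theta x 1"
    by (rule theta_sum_LIMSEQ_3) (use assms in simp)
  moreover have "(\<lambda>m. 2 * theta_sum (x ^ 6) (x ^ 3) m + x * theta_sum (x ^ 9) 1 m) \<longlonglongrightarrow>
    2 * theta (x ^ 6) (x ^ 3) + x * theta (x ^ 9) 1"
    using assms by (intro tendsto_intros theta_sum_LIMSEQ) (auto simp: fps_power_zeroth)
  ultimately show ?thesis
    by (rule LIMSEQ_eqI)
qed

text \<open>The exponents are the squares: (3i)^2 gives the series in x^9, while 3i - 1 and 3i + 1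
  give reflections of each other.\<close>

lemma theta_phi_dissection:
  assumes "fps_nth x 0 = 0"
  shows "theta x x = theta (x ^ 9) (x ^ 9) + 2 * x * theta (x ^ 15) (x ^ 3)"
proof -
  have "theta_sum x x (3 * m + 1) = theta_sum (x ^ 9) (x ^ 9) m + 2 * x * theta_sum (x ^ 15) (x ^ 3) m" for m
  proof -
    have e: "tri (3 * i) + tri (3 * i - 1) = 9 * tri i + 9 * tri (i - 1)"
      "tri (3 * i - 1) + tri (3 * i - 1 - 1) = Suc (3 * tri i + 15 * tri (i - 1))"
      "tri (3 * i + 1) + tri (3 * i + 1 - 1) = Suc (15 * tri i + 3 * tri (i - 1))" for i
    proof -
      have "tri (3 * i) = 6 * tri i + 3 * tri (i - 1)" "tri (3 * i - 1) = 3 * tri i + 6 * tri (i - 1)"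
        "tri (3 * i + 1) = Suc (9 * tri i)" "tri (3 * i - 2) = Suc (9 * tri (i - 1))"
        using two_tri[of i] two_tri[of "i - 1"] by (auto intro!: tri_eqI simp: algebra_simps)
      then show "tri (3 * i) + tri (3 * i - 1) = 9 * tri i + 9 * tri (i - 1)"
        "tri (3 * i - 1) + tri (3 * i - 1 - 1) = Suc (3 * tri i + 15 * tri (i - 1))"
        "tri (3 * i + 1) + tri (3 * i + 1 - 1) = Suc (15 * tri i + 3 * tri (i - 1))"
        by simp_all
    qed
    have "theta_sum x x (3 * m + 1) = theta_sum (x ^ 9) (x ^ 9) m + x * theta_sum (x ^ 3) (x ^ 15) m
        + x * theta_sum (x ^ 15) (x ^ 3) m"
      unfolding theta_sum_def sum_symmetric_mod_3 theta_term_def power_add[symmetric] e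
      by (simp add: power_add power_mult sum_distrib_left)
    then show ?thesis
      by (simp add: theta_sum_reflect[of "x ^ 3"])
  qed
  moreover have "(\<lambda>m. theta_sum x x (3 * m + 1)) \<longlonglongrightarrow> theta x x"
    by (rule theta_sum_LIMSEQ_3) (use assms in simp)
  moreover have "(\<lambda>m. theta_sum (x ^ 9) (x ^ 9) m + 2 * x * theta_sum (x ^ 15) (x ^ 3) m) \<longlonglongrightarrow>
    theta (x ^ 9) (x ^ 9) + 2 * x * theta (x ^ 15) (x ^ 3)"
    using assms by (intro tendsto_intros theta_sum_LIMSEQ) (auto simp: fps_power_zeroth)
  ultimately show ?thesis
    by (rule LIMSEQ_eqI)
qed

subsection \<open>Power series over the field with three elements\<close>

type_synonym gf3 = Enum.finite_3

(* These simp rules would replace the numerals of the field by its constructors. *)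
declare zero_finite_3_def [simp del] one_finite_3_def [simp del] two_finite_3 [simp del]

lemma gf3_cases: "c = 0 \<or> c = 1 \<or> c = (- 1 :: gf3)"
  by (cases c) (simp_all add: zero_finite_3_def one_finite_3_def uminus_finite_3_def)

lemma gf3_cube: "c ^ 3 = (c :: gf3)"
  using gf3_cases[of c] by auto

lemma gf3_three: "(3 :: gf3) = 0"
  by (simp add: numeral.simps plus_finite_3_def one_finite_3_def zero_finite_3_def)

lemma CHAR_gf3: "CHAR(gf3) = 3"
proof -
  have "CHAR(gf3) dvd 3"
    using gf3_three of_nat_eq_0_iff_char_dvd[of 3, where 'a = gf3] by simp
  moreover have "CHAR(gf3) \<noteq> 1"
    by (metis of_nat_1 of_nat_CHAR zero_neq_one)
  ultimately show ?thesis
    using prime_nat_iff[of 3] by auto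
qed

lemma three_eq_0: "(3 :: gf3 fps) = 0"
  using of_nat_CHAR[where 'a = "gf3 fps"] by (simp add: CHAR_gf3)

lemma two_eq_minus_1: "(2 :: gf3 fps) = - 1"
  using three_eq_0 by (simp add: eq_neg_iff_add_eq_0)

lemma cube_sum: "(\<Sum>i\<in>A. f i) ^ 3 = (\<Sum>i\<in>A. f i ^ 3)" for f :: "_ \<Rightarrow> gf3 fps"
  by (rule freshmans_dream_sum) (simp_all add: CHAR_gf3)

lemma cube_diff: "(x - y) ^ 3 = x ^ 3 - y ^ 3" for x y :: "gf3 fps"
proof -
  have "(x + - y) ^ 3 = x ^ 3 + (- y) ^ 3"
    by (rule freshmans_dream) (simp_all add: CHAR_gf3)
  then show ?thesis by simp
qed

text \<open>In characteristic 3 cubing is additive, so it passes into every factor and then to the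
  limit.\<close>

lemma euler_cube:
  fixes x :: "gf3 fps"
  assumes "fps_nth x 0 = 0"
  shows "euler (x ^ 3) = euler x ^ 3"
proof -
  have "qpoch (x ^ 3) m = qpoch x m ^ 3" for m
    unfolding qpoch_def prod_power_distrib cube_diff by (simp only: power_one power_mult[symmetric] mult.commute)
  moreover have "qpoch (x ^ 3) \<longlonglongrightarrow> euler (x ^ 3)"
    using assms by (intro qpoch_LIMSEQ) (simp add: fps_power_zeroth)
  moreover have "(\<lambda>m. qpoch x m ^ 3) \<longlonglongrightarrow> euler x ^ 3"
    using assms by (intro tendsto_intros qpoch_LIMSEQ)
  ultimately show ?thesis by (rule LIMSEQ_eqI)
qed

lemma theta_cube:
  fixes a b :: "gf3 fps"
  assumes "fps_nth (a * b) 0 = 0"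
  shows "theta (a ^ 3) (b ^ 3) = theta a b ^ 3"
proof -
  have "theta_sum (a ^ 3) (b ^ 3) m = theta_sum a b m ^ 3" for m
    unfolding theta_sum_def cube_sum theta_term_def power_mult_distrib
    by (simp only: power_mult[symmetric] mult.commute)
  moreover have "theta_sum (a ^ 3) (b ^ 3) \<longlonglongrightarrow> theta (a ^ 3) (b ^ 3)"
    using assms by (intro theta_sum_LIMSEQ) (auto simp: fps_power_zeroth)
  moreover have "(\<lambda>m. theta_sum a b m ^ 3) \<longlonglongrightarrow> theta a b ^ 3"
    using assms by (intro tendsto_intros theta_sum_LIMSEQ)
  ultimately show ?thesis by (rule LIMSEQ_eqI)
qed

section \<open>Extraction of residue classes of exponents modulo 3\<close>

definition section_mod_3 :: "nat \<Rightarrow> gf3 fps \<Rightarrow> gf3 fps" where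
  "section_mod_3 r f = Abs_fps (\<lambda>n. fps_nth f (3 * n + r))"

lemma section_mod_3_nth [simp]: "fps_nth (section_mod_3 r f) n = fps_nth f (3 * n + r)"
  by (simp add: section_mod_3_def)

lemma section_mod_3_add: "section_mod_3 r (f + g) = section_mod_3 r f + section_mod_3 r g"
  and section_mod_3_minus: "section_mod_3 r (- f) = - section_mod_3 r f"
  by (simp_all add: fps_eq_iff)

text \<open>Over this field f(q)^3 = f(q^3): truncations satisfy it by additivity of cubing and
  \<open>gf3_cube\<close>, and the limit inherits it.\<close>

lemma fps_nth_cube:
  fixes f :: "gf3 fps"
  shows "fps_nth (f ^ 3) n = (if 3 dvd n then fps_nth f (n div 3) else 0)"
proof -
  let ?s = "\<lambda>m. \<Sum>i=0..m. fps_const (fps_nth f i) * fps_X ^ i"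
  have "(\<lambda>m. ?s m ^ 3) \<longlonglongrightarrow> f ^ 3"
    by (intro tendsto_intros fps_notation)
  then have "\<forall>\<^sub>F m in sequentially. fps_nth (?s m ^ 3) n = fps_nth (f ^ 3) n"
    unfolding tendsto_fps_iff by blast
  then obtain m where m: "m \<ge> n" "fps_nth (?s m ^ 3) n = fps_nth (f ^ 3) n"
    unfolding eventually_sequentially by (meson nle_le)
  have "?s m ^ 3 = (\<Sum>i=0..m. fps_const (fps_nth f i) * fps_X ^ (3 * i))"
    unfolding cube_sum power_mult_distrib fps_const_power gf3_cube by (simp only: power_mult[symmetric] mult.commute)
  then have "fps_nth (?s m ^ 3) n = fps_nth (\<Sum>i=0..m. fps_const (fps_nth f i) * fps_X ^ (3 * i)) n"
    by (rule arg_cong)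
  also have "\<dots> = (\<Sum>i=0..m. if 3 * i = n then fps_nth f i else 0)"
    unfolding fps_sum_nth by (auto intro!: sum.cong)
  also have "\<dots> = (if 3 dvd n then fps_nth f (n div 3) else 0)"
  proof (cases "3 dvd n")
    case True
    then obtain k where k: "n = 3 * k" by blast
    with m(1) show ?thesis by (auto simp: sum.delta)
  next
    case False
    then show ?thesis by (auto intro!: sum.neutral)
  qed
  finally show ?thesis
    using m(2) by simp
qed

text \<open>As g^3 is a series in q^3, it factors out of the section and becomes g. Hence the later
  identities are arranged around cubes.\<close>

lemma section_mod_3_mult_cube: "section_mod_3 r (f * g ^ 3) = section_mod_3 r f * g" if "r < 3"
proof (rule fps_ext)
  fix n
  have "fps_nth (section_mod_3 r (f * g ^ 3)) n =
    (\<Sum>i\<in>{0..3 * n + r}. fps_nth (g ^ 3) i * fps_nth f (3 * n + r - i))"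
    by (simp add: mult.commute[of f] fps_mult_nth)
  also have "\<dots> = (\<Sum>i\<in>(\<lambda>j. 3 * j) ` {0..n}. fps_nth (g ^ 3) i * fps_nth f (3 * n + r - i))"
  proof (rule sum.mono_neutral_right)
    show "\<forall>i\<in>{0..3 * n + r} - (\<lambda>j. 3 * j) ` {0..n}. fps_nth (g ^ 3) i * fps_nth f (3 * n + r - i) = 0"
    proof
      fix i assume i: "i \<in> {0..3 * n + r} - (\<lambda>j. 3 * j) ` {0..n}"
      have "\<not> 3 dvd i"
      proof
        assume "3 dvd i"
        then obtain j where "i = 3 * j" by blast
        with i that show False by auto
      qed
      then show "fps_nth (g ^ 3) i * fps_nth f (3 * n + r - i) = 0"
        by (simp add: fps_nth_cube)
    qed
  qed auto
  also have "\<dots> = (\<Sum>j\<in>{0..n}. fps_nth g j * fps_nth f (3 * (n - j) + r))"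
  proof (subst sum.reindex)
    have "3 * n + r - 3 * j = 3 * (n - j) + r" if "j \<le> n" for j
      using that by simp
    then show "(\<Sum>j\<in>{0..n}. ((\<lambda>i. fps_nth (g ^ 3) i * fps_nth f (3 * n + r - i)) \<circ> (\<lambda>j. 3 * j)) j) =
        (\<Sum>j\<in>{0..n}. fps_nth g j * fps_nth f (3 * (n - j) + r))"
      by (intro sum.cong) (simp_all add: fps_nth_cube)
  qed (simp add: inj_on_def)
  also have "\<dots> = fps_nth (section_mod_3 r f * g) n"
    by (simp add: mult.commute[of _ g] fps_mult_nth)
  finally show "fps_nth (section_mod_3 r (f * g ^ 3)) n = fps_nth (section_mod_3 r f * g) n" .
qed

lemma section_mod_3_X_power:
  "s < 3 \<Longrightarrow> r < 3 \<Longrightarrow> section_mod_3 r (fps_X ^ s) = (if r = s then 1 else 0)"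
  by (auto simp: fps_eq_iff; presburger)

text \<open>Reads a section off a dissection; the explicit \<open>fps_X ^ 0\<close> and
  \<open>fps_X ^ 1\<close> below are there to match this form.\<close>

lemma section_mod_3_X_power_mult_cube:
  assumes "s < 3" "r < 3"
  shows "section_mod_3 r (fps_X ^ s * g ^ 3) = (if r = s then g else 0)"
  using assms by (simp add: section_mod_3_mult_cube section_mod_3_X_power)

subsection \<open>The generating function of PEND partitions\<close>

text \<open>The exponent \<open>e\<close> is \<open>k\<close> times the multiplicity of the part \<open>k\<close>.\<close>
definition pend_factor :: "nat \<Rightarrow> gf3 fps" where
  "pend_factor k = Abs_fps (\<lambda>e. if k dvd e \<and> (even k \<longrightarrow> e \<noteq> k) then 1 else 0)"

definition pend_fps :: "gf3 fps" where
  "pend_fps = Abs_fps (\<lambda>n. of_nat (pend n))"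

text \<open>A partition corresponds to the multiset in which each of its parts \<open>k\<close> is replaced by \<open>k\<close> copies of \<open>k\<close>.\<close>
lemma pend_eq_card_multisets_of_size:
  assumes "n \<le> m"
  shows "pend n = card {X \<in> multisets_of_size {1..m} n. \<forall>k\<in>{1..m}. k dvd count X k \<and> (even k \<longrightarrow> count X k \<noteq> k)}"
    (is "_ = card ?B")
proof -
  define F :: "nat multiset \<Rightarrow> nat multiset" where "F P = (\<Sum>x\<in>#P. replicate_mset x x)" for P
  \<comment> \<open>\<open>G\<close> inverts \<open>F\<close> by dividing multiplicities;
    multiplicity 1 of an even part \<open>k\<close> corresponds to
    \<open>count X k = k\<close>.\<close>
  define G :: "nat multiset \<Rightarrow> nat multiset" where "G X = (\<Sum>k\<in>{1..m}. replicate_mset (count X k div k) k)" for X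
  have count_F: "count (F P) k = k * count P k" for P k
    by (induction P) (auto simp: F_def)
  have size_F: "size (F P) = \<Sum>\<^sub># P" for P
    by (induction P) (auto simp: F_def)
  have count_G: "count (G X) k = (if k \<in> {1..m} then count X k div k else 0)" for X k
    by (simp add: G_def count_sum)
  have le: "x \<le> n" if "x \<in># P" "P \<in> partitions n" for x P
    using that unfolding partitions_def by (auto dest!: multi_member_split)
  have "bij_betw F {P \<in> partitions n. PEND P} ?B"
  proof (rule bij_betw_byWitness[where f' = G])
    show "\<forall>P\<in>{P \<in> partitions n. PEND P}. G (F P) = P"
    proof
      fix P assume P: "P \<in> {P \<in> partitions n. PEND P}"
      show "G (F P) = P"
      proof (rule multiset_eqI)
        fix k
        have "k \<in> {1..m}" if "k \<in># P"
          using le[OF that] P that assms by (cases k) (auto simp: partitions_def)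
        then show "count (G (F P)) k = count P k"
          by (cases "k \<in># P") (auto simp: count_G count_F not_in_iff)
      qed
    qed
    show "\<forall>X\<in>?B. F (G X) = X"
    proof
      fix X assume X: "X \<in> ?B"
      show "F (G X) = X"
      proof (rule multiset_eqI)
        fix k
        show "count (F (G X)) k = count X k"
        proof (cases "k \<in> {1..m}")
          case True
          with X show ?thesis by (auto simp: count_G count_F)
        next
          case False
          with X have "k \<notin># X" by (auto simp: multisets_of_size_def)
          with False show ?thesis by (auto simp: count_G count_F not_in_iff)
        qed
      qed
    qed
    show "F ` {P \<in> partitions n. PEND P} \<subseteq> ?B"
    proof
      fix X assume "X \<in> F ` {P \<in> partitions n. PEND P}"
      then obtain P where P: "P \<in> partitions n" "PEND P" "X = F P" by blast
      have "x \<in> {1..m}" if "x \<in># X" for x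
      proof -
        have "count (F P) x \<noteq> 0" using that P by simp
        then have "x \<noteq> 0" "x \<in># P" by (auto simp: count_F)
        with le[of x P] P assms show ?thesis by auto
      qed
      with P show "X \<in> ?B"
        by (auto simp: multisets_of_size_def size_F count_F PEND_def partitions_def)
    qed
    show "G ` ?B \<subseteq> {P \<in> partitions n. PEND P}"
    proof
      fix P assume "P \<in> G ` ?B"
      then obtain X where X: "X \<in> ?B" "P = G X" by blast
      have "F P = X"
        using \<open>\<forall>X\<in>?B. F (G X) = X\<close> X by blast
      then have "\<Sum>\<^sub># P = n"
        using X size_F[of P] by (auto simp: multisets_of_size_def)
      moreover have "0 \<notin># P"
        unfolding not_in_iff X(2) count_G by simp
      moreover have "PEND P"
        unfolding PEND_def
      proof (intro allI impI)
        fix k :: nat assume "even k"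
        show "count P k \<noteq> 1"
        proof
          assume c: "count P k = 1"
          then have "k \<in> {1..m}" using X by (auto simp: count_G split: if_splits)
          moreover have "count X k = k"
            using c count_F[of P k] \<open>F P = X\<close> by simp
          ultimately show False using X \<open>even k\<close> by auto
        qed
      qed
      ultimately show "P \<in> {P \<in> partitions n. PEND P}"
        by (simp add: partitions_def)
    qed
  qed
  then show ?thesis
    unfolding pend_def by (rule bij_betw_same_card)
qed

lemma prod_indicator: "finite A \<Longrightarrow> (\<Prod>k\<in>A. if P k then 1 else 0) = (if \<forall>k\<in>A. P k then 1 else (0 :: 'a :: comm_semiring_1))"
  by (induction A rule: finite_induct) auto

lemma pend_factor_LIMSEQ: "(\<lambda>m. \<Prod>k\<in>{1..m}. pend_factor k) \<longlonglongrightarrow> pend_fps"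
proof (rule tendsto_fpsI)
  fix n
  show "\<forall>\<^sub>F m in sequentially. fps_nth (\<Prod>k\<in>{1..m}. pend_factor k) n = fps_nth pend_fps n"
    using eventually_ge_at_top[of n]
  proof eventually_elim
    case (elim m)
    have "finite (multisets_of_size {1..m} n)"
      by (rule finite_multisets_of_size) simp
    then show ?case
      \<comment> \<open>The coefficient is a sum over multisets of products of coefficients, one for
        each multiplicity. These are 0 or 1 here, so the sum counts.\<close>
      by (subst fps_prod_nth')
        (simp_all add: pend_factor_def prod_indicator pend_fps_def pend_eq_card_multisets_of_size[OF elim]
          flip: sum.inter_filter)
  qed
qed

lemma pend_factor_mult:
  assumes "k > 0"
  shows "pend_factor k * (1 - fps_X ^ k) = (if even k then (1 + fps_X ^ k) ^ 2 else 1)"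
proof -
  \<comment> \<open>The geometric series 1 / (1 - q^k), which allows every multiplicity; even parts
    lose the term q^k.\<close>
  define h :: "gf3 fps" where "h = Abs_fps (\<lambda>e. if k dvd e then 1 else 0)"
  have h: "h * (1 - fps_X ^ k) = 1"
  proof (rule fps_ext)
    fix e
    have "fps_nth (h * (1 - fps_X ^ k)) e = fps_nth h e - fps_nth (h * fps_X ^ k) e"
      by (simp add: right_diff_distrib)
    also have "\<dots> = (if e = 0 then 1 else 0)"
      using assms by (auto simp: h_def fps_X_power_mult_right_nth dvd_minus_self dest: dvd_imp_le)
    finally show "fps_nth (h * (1 - fps_X ^ k)) e = fps_nth 1 e" by simp
  qed
  show ?thesis
  proof (cases "even k")
    case True
    have "pend_factor k = h - fps_X ^ k"
      using True by (auto simp: fps_eq_iff pend_factor_def h_def)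
    then have "pend_factor k * (1 - fps_X ^ k) = 1 - fps_X ^ k * (1 - fps_X ^ k)"
      by (simp add: left_diff_distrib h)
    also have "\<dots> = (1 + fps_X ^ k) ^ 2 - 3 * fps_X ^ k"
      by (simp add: power2_eq_square algebra_simps)
    finally show ?thesis
      using True by (simp add: three_eq_0)
  next
    case False
    then have "pend_factor k = h"
      by (simp add: pend_factor_def h_def)
    with h False show ?thesis by simp
  qed
qed

text \<open>The factor f_1 clears the denominators 1 - q^k, and f_2^2 completes (1 + q^k)^2 to (1 -
  q^(2k))^2 for even k.\<close>

lemma pend_fps_product:
  "pend_fps * euler fps_X * euler (fps_X ^ 2) ^ 2 = euler (fps_X ^ 4) ^ 2"
proof -
  have "(\<Prod>k\<in>{1..2 * m}. pend_factor k) * qpoch fps_X (2 * m) * qpoch (fps_X ^ 2) m ^ 2 = qpoch (fps_X ^ 4) m ^ 2" for m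
  proof (induction m)
    case (Suc m)
    let ?a = "1 - fps_X ^ Suc (2 * m) :: gf3 fps" and ?z = "fps_X ^ Suc (Suc (2 * m)) :: gf3 fps"
    have z: "(fps_X ^ 2) ^ Suc m = ?z" "(fps_X ^ 4) ^ Suc m = ?z ^ 2"
      by (simp_all only: flip: power_mult) (rule arg_cong[of _ _ "\<lambda>n. fps_X ^ n"], simp)+
    have two: "2 * Suc m = Suc (Suc (2 * m))" by simp
    have p: "(\<Prod>k\<in>{1..2 * Suc m}. pend_factor k) =
        (\<Prod>k\<in>{1..2 * m}. pend_factor k) * pend_factor (Suc (2 * m)) * pend_factor (Suc (Suc (2 * m)))"
      by (simp add: mult.assoc)
    have "(\<Prod>k\<in>{1..2 * Suc m}. pend_factor k) * qpoch fps_X (2 * Suc m) * qpoch (fps_X ^ 2) (Suc m) ^ 2 =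
      ((\<Prod>k\<in>{1..2 * m}. pend_factor k) * qpoch fps_X (2 * m) * qpoch (fps_X ^ 2) m ^ 2) *
      (pend_factor (Suc (2 * m)) * ?a) * (pend_factor (Suc (Suc (2 * m))) * (1 - ?z)) * (1 - ?z) ^ 2"
      unfolding p unfolding two qpoch_Suc z power_mult_distrib by (simp only: mult_ac)
    also have "\<dots> = qpoch (fps_X ^ 4) m ^ 2 * ((1 + ?z) * (1 - ?z)) ^ 2"
      by (subst (1 2) pend_factor_mult) (simp_all only: Suc.IH power_mult_distrib, simp_all)
    also have "(1 + ?z) * (1 - ?z) = 1 - ?z ^ 2"
      by (simp add: algebra_simps power2_eq_square del: power_Suc)
    finally show ?case
      unfolding qpoch_Suc z power_mult_distrib .
  qed auto
  moreover have "(\<lambda>m. (\<Prod>k\<in>{1..2 * m}. pend_factor k) * qpoch fps_X (2 * m) * qpoch (fps_X ^ 2) m ^ 2)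
      \<longlonglongrightarrow> pend_fps * euler fps_X * euler (fps_X ^ 2) ^ 2"
  proof (intro tendsto_mult tendsto_power_strong tendsto_const qpoch_LIMSEQ qpoch_LIMSEQ_mult)
    show "(\<lambda>m. \<Prod>k\<in>{1..2 * m}. pend_factor k) \<longlonglongrightarrow> pend_fps"
      using LIMSEQ_subseq_LIMSEQ[OF pend_factor_LIMSEQ, of "\<lambda>m. 2 * m"] by (simp add: strict_mono_def o_def)
  qed auto
  moreover have "(\<lambda>m. qpoch (fps_X ^ 4) m ^ 2) \<longlonglongrightarrow> euler (fps_X ^ 4 :: gf3 fps) ^ 2"
    by (intro tendsto_power_strong tendsto_const qpoch_LIMSEQ) auto
  ultimately show ?thesis by (rule LIMSEQ_eqI)
qed

subsection \<open>Dissection of the generating function\<close>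

text \<open>Both parts of the dissection are powers of theta functions in x itself, by
  \<open>theta_cube\<close>.\<close>

lemma psi_dissection:
  fixes x :: "gf3 fps"
  assumes "fps_nth x 0 = 0"
  shows "theta x 1 = x * theta x 1 ^ 9 - theta (x ^ 2) x ^ 3"
proof -
  have "theta (x ^ 6) (x ^ 3) = theta (x ^ 2) x ^ 3"
    using theta_cube[of "x ^ 2" x] assms by (simp flip: power_mult)
  moreover have "theta (x ^ 9) 1 = (theta x 1 ^ 3) ^ 3"
    using theta_cube[of "x ^ 3" 1] theta_cube[of x 1] assms by (simp add: fps_power_zeroth flip: power_mult)
  ultimately show ?thesis
    using theta_psi_dissection[OF assms] by (simp add: two_eq_minus_1 flip: power_mult)
qed

lemma phi_dissection:
  fixes x :: "gf3 fps"
  assumes "fps_nth x 0 = 0"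
  shows "theta x x = theta x x ^ 9 - x * theta (x ^ 5) x ^ 3"
proof -
  have "theta (x ^ 15) (x ^ 3) = theta (x ^ 5) x ^ 3"
    using theta_cube[of "x ^ 5" x] assms by (simp flip: power_mult)
  moreover have "theta (x ^ 9) (x ^ 9) = (theta x x ^ 3) ^ 3"
    using theta_cube[of "x ^ 3" "x ^ 3"] theta_cube[of x x] assms by (simp add: fps_power_zeroth flip: power_mult)
  ultimately show ?thesis
    using theta_phi_dissection[OF assms] by (simp add: two_eq_minus_1 flip: power_mult)
qed

text \<open>The dissection of p = \<phi>(-q^2) has the classes 0 and 2 only, so its square has p^18
  in class 0, the cross term in class 2 and q^4 C^6 in class 1.\<close>

lemma section_mod_3_0_phi_square:
  "section_mod_3 0 (theta (- (fps_X ^ 2)) (- (fps_X ^ 2)) ^ 2) = theta (- (fps_X ^ 2)) (- (fps_X ^ 2)) ^ 6"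
proof -
  define p C where "p = theta (- (fps_X ^ 2)) (- (fps_X ^ 2) :: gf3 fps)"
    and "C = theta ((- (fps_X ^ 2)) ^ 5) (- (fps_X ^ 2) :: gf3 fps)"
  have p: "p = p ^ 9 + fps_X ^ 2 * C ^ 3"
    using phi_dissection[of "- (fps_X ^ 2)"] unfolding p_def C_def by simp
  have "(u + v) ^ 2 = u ^ 2 - u * v + v ^ 2 + 3 * (u * v)" for u v :: "gf3 fps"
    by (simp add: power2_eq_square algebra_simps)
  then have "p ^ 2 = (p ^ 9) ^ 2 - p ^ 9 * (fps_X ^ 2 * C ^ 3) + (fps_X ^ 2 * C ^ 3) ^ 2"
    by (subst p) (simp add: three_eq_0)
  also have "\<dots> = fps_X ^ 0 * (p ^ 6) ^ 3 + - (fps_X ^ 2 * (p ^ 3 * C) ^ 3) + fps_X ^ 1 * (fps_X * C ^ 2) ^ 3"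
    by (simp add: power_mult_distrib flip: power_mult power_add) (simp add: algebra_simps eval_nat_numeral)
  finally have square: "p ^ 2 = fps_X ^ 0 * (p ^ 6) ^ 3 + - (fps_X ^ 2 * (p ^ 3 * C) ^ 3) + fps_X ^ 1 * (fps_X * C ^ 2) ^ 3" .
  have "section_mod_3 0 (p ^ 2) = p ^ 6"
    unfolding square section_mod_3_add section_mod_3_minus by (simp only: section_mod_3_X_power_mult_cube) simp
  then show ?thesis by (simp add: p_def)
qed

text \<open>The series with coefficients c(n) of the introduction; the sign compensates for
  \<open>theta fps_X 1\<close> being -\<psi>(q).\<close>

definition reduced_fps :: "gf3 fps" where
  "reduced_fps = - theta fps_X 1 * theta (- (fps_X ^ 2)) (- (fps_X ^ 2)) ^ 6"

text \<open>Since \<phi>^6 is a cube, only \<psi> needs dissecting, and it has no exponents of class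
  2. The local \<psi> is the negative of the usual one.\<close>

lemma reduced_fps_decomposition:
  defines "\<psi> \<equiv> theta fps_X 1 :: gf3 fps" and "\<phi> \<equiv> theta (- (fps_X ^ 2)) (- (fps_X ^ 2)) :: gf3 fps"
  shows "reduced_fps = fps_X ^ 0 * (theta (fps_X ^ 2) fps_X * \<phi> ^ 2) ^ 3 + fps_X ^ 1 * (- (\<psi> ^ 3 * \<phi> ^ 2)) ^ 3"
proof -
  have psi: "\<psi> = fps_X * \<psi> ^ 9 - theta (fps_X ^ 2) fps_X ^ 3"
    unfolding \<psi>_def by (rule psi_dissection) simp
  have "reduced_fps = - \<psi> * \<phi> ^ 6"
    unfolding reduced_fps_def \<psi>_def \<phi>_def ..
  also have "\<dots> = - (fps_X * \<psi> ^ 9 - theta (fps_X ^ 2) fps_X ^ 3) * \<phi> ^ 6"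
    using psi by (rule arg_cong)
  finally show ?thesis
    by (simp add: power_mult_distrib algebra_simps flip: power_mult)
qed

lemma reduced_fps_nth_2: "fps_nth reduced_fps (3 * n + 2) = 0"
proof -
  have "section_mod_3 2 reduced_fps = 0"
    unfolding reduced_fps_decomposition section_mod_3_add by (simp only: section_mod_3_X_power_mult_cube) simp
  then show ?thesis
    by (metis fps_zero_nth section_mod_3_nth)
qed

text \<open>The section of class 1 is \<phi>^2 times a cube, up to sign, and the next section turns
  \<phi>^2 back into \<phi>^6.\<close>

lemma reduced_fps_nth_1: "fps_nth reduced_fps (9 * n + 1) = fps_nth reduced_fps n"
proof -
  define \<psi> \<phi> where "\<psi> = (theta fps_X 1 :: gf3 fps)"
    and "\<phi> = (theta (- (fps_X ^ 2)) (- (fps_X ^ 2)) :: gf3 fps)"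
  have "section_mod_3 1 reduced_fps = - (\<psi> ^ 3 * \<phi> ^ 2)"
    unfolding reduced_fps_decomposition section_mod_3_add \<psi>_def \<phi>_def
    by (simp only: section_mod_3_X_power_mult_cube) simp
  also have "section_mod_3 0 \<dots> = - (section_mod_3 0 (\<phi> ^ 2) * \<psi>)"
    unfolding section_mod_3_minus mult.commute[of "\<psi> ^ 3"] by (simp add: section_mod_3_mult_cube)
  also have "\<dots> = reduced_fps"
    unfolding \<phi>_def \<psi>_def section_mod_3_0_phi_square reduced_fps_def by simp
  finally have "fps_nth (section_mod_3 0 (section_mod_3 1 reduced_fps)) n = fps_nth reduced_fps n"
    by (rule arg_cong)
  then show ?thesis by (simp add: algebra_simps)
qed

text \<open>Identities between quotients of Euler products are cross-multiplied, then nonzero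
  factors are cancelled.\<close>

lemma section_mod_3_pend:
  "section_mod_3 0 (section_mod_3 1 pend_fps) = reduced_fps"
proof -
  define x where "x = (- fps_X :: gf3 fps)"
  define f1 f2 f4 g where "f1 = euler (fps_X :: gf3 fps)" and "f2 = euler (fps_X ^ 2 :: gf3 fps)"
    and "f4 = euler (fps_X ^ 4 :: gf3 fps)" and "g = euler x"
  define A \<psi> \<psi>' \<phi> where "A = theta (x ^ 2) x" and "\<psi> = theta (fps_X :: gf3 fps) 1"
    and "\<psi>' = theta x 1" and "\<phi> = theta (- (fps_X ^ 2)) (- (fps_X ^ 2) :: gf3 fps)"
  define P1 where "P1 = section_mod_3 1 pend_fps"
  have x [simp]: "fps_nth x 0 = 0" and x2: "x ^ 2 = fps_X ^ 2"
    by (simp_all add: x_def)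
  have nz: "f1 \<noteq> 0" "f2 \<noteq> 0" "f4 \<noteq> 0" "g \<noteq> 0"
    unfolding f1_def f2_def f4_def g_def by (auto intro!: euler_nonzero)

  have pend: "pend_fps * f1 * f2 ^ 2 = f4 ^ 2"
    unfolding f1_def f2_def f4_def by (rule pend_fps_product)
  have psi: "\<psi> * f1 = - (f2 ^ 2)"
    unfolding \<psi>_def f1_def f2_def by (subst theta_psi_product) (auto simp: two_eq_minus_1)
  have psi': "\<psi>' * g = - (f2 ^ 2)"
    unfolding \<psi>'_def g_def f2_def x2[symmetric] by (subst theta_psi_product) (auto simp: two_eq_minus_1)
  have phi: "\<phi> * f4 = f2 ^ 2"
    unfolding \<phi>_def f4_def f2_def using theta_phi_product[of "fps_X ^ 2 :: gf3 fps"] by (simp flip: power_mult)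
  have g: "f1 * g * f4 = f2 ^ 3"
    unfolding f1_def g_def f4_def f2_def x_def by (rule euler_uminus) simp
  \<comment> \<open>In characteristic 3 the Euler products in x^3 and x^6 of
    \<open>theta_cubic_product\<close> are cubes.\<close>
  have A: "A * f2 ^ 2 = g ^ 5"
  proof -
    have "euler (x ^ 3) = g ^ 3" "euler (x ^ 6) = f2 ^ 3"
      using euler_cube[of x] euler_cube[of "x ^ 2"] unfolding g_def f2_def x2[symmetric]
      by (simp_all add: fps_power_zeroth flip: power_mult)
    then have "A * f2 ^ 3 * g = f2 * (g ^ 3) ^ 2"
      using theta_cubic_product[of x] unfolding A_def g_def f2_def x2[symmetric] by simp
    then have "(f2 * g) * (A * f2 ^ 2) = (f2 * g) * g ^ 5"
      by (simp add: eval_nat_numeral algebra_simps)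
    then show ?thesis using nz by simp
  qed

  have "pend_fps * f1 ^ 3 = \<psi>' ^ 2"
  proof -
    have "(f2 ^ 2 * g ^ 2) * (pend_fps * f1 ^ 3) = (pend_fps * f1 * f2 ^ 2) * f1 ^ 2 * g ^ 2"
      by algebra
    also have "\<dots> = (f1 * g * f4) ^ 2"
      unfolding pend by algebra
    also have "\<dots> = f2 ^ 2 * (- (f2 ^ 2)) ^ 2"
      unfolding g by (simp flip: power_mult power_add)
    also have "\<dots> = (f2 ^ 2 * g ^ 2) * \<psi>' ^ 2"
      unfolding psi'[symmetric] by algebra
    finally show ?thesis using nz by simp
  qed
  also have "\<psi>' ^ 2 = fps_X ^ 0 * (A ^ 2) ^ 3 + - (fps_X ^ 1 * (A * \<psi>' ^ 3) ^ 3) + fps_X ^ 2 * (\<psi>' ^ 6) ^ 3"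
  proof -
    have "\<psi>' = x * \<psi>' ^ 9 - A ^ 3"
      unfolding \<psi>'_def A_def by (rule psi_dissection) simp
    then have "\<psi>' ^ 2 = (x * \<psi>' ^ 9 - A ^ 3) ^ 2"
      by (rule arg_cong)
    also have "\<dots> = x ^ 2 * (\<psi>' ^ 9) ^ 2 + x * \<psi>' ^ 9 * A ^ 3 + (A ^ 3) ^ 2 - 3 * (x * \<psi>' ^ 9 * A ^ 3)"
      by algebra
    finally show ?thesis
      unfolding three_eq_0 x_def by (simp add: power_mult_distrib algebra_simps flip: power_mult)
  qed
  finally have mult: "pend_fps * f1 ^ 3 =
    fps_X ^ 0 * (A ^ 2) ^ 3 + - (fps_X ^ 1 * (A * \<psi>' ^ 3) ^ 3) + fps_X ^ 2 * (\<psi>' ^ 6) ^ 3" .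
  have "section_mod_3 1 (pend_fps * f1 ^ 3) = - (A * \<psi>' ^ 3)"
    unfolding mult section_mod_3_add section_mod_3_minus by (simp only: section_mod_3_X_power_mult_cube) simp
  then have P1: "P1 * f1 = - (A * \<psi>' ^ 3)"
    by (simp add: section_mod_3_mult_cube P1_def)

  \<comment> \<open>Up to cubes, \<open>A\<close> is \<open>f1\<close> times \<phi>^2. This prepares
    the second section, since that of \<phi>^2 is known.\<close>
  have A': "A * f1 ^ 6 * f4 ^ 3 = f1 * \<phi> ^ 2 * f2 ^ 9"
  proof -
    have "(f2 ^ 2 * f4 ^ 2) * (A * f1 ^ 6 * f4 ^ 3) = f1 * (f1 * g * f4) ^ 5"
      using A by algebra
    also have "\<dots> = f1 * (f2 ^ 2) ^ 2 * f2 ^ 9 * f2 ^ 2"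
      unfolding g by (simp flip: power_mult power_add add: mult.assoc)
    also have "\<dots> = (f2 ^ 2 * f4 ^ 2) * (f1 * \<phi> ^ 2 * f2 ^ 9)"
      unfolding phi[symmetric] by algebra
    finally show ?thesis using nz by simp
  qed
  have "f1 * (P1 * (f1 ^ 2 * f4) ^ 3) = (P1 * f1) * f1 ^ 6 * f4 ^ 3"
    by algebra
  also have "\<dots> = - (A * f1 ^ 6 * f4 ^ 3) * \<psi>' ^ 3"
    unfolding P1 by algebra
  also have "\<dots> = f1 * - (\<phi> ^ 2 * (f2 ^ 3 * \<psi>') ^ 3)"
    unfolding A' by algebra
  finally have "P1 * (f1 ^ 2 * f4) ^ 3 = - (\<phi> ^ 2 * (f2 ^ 3 * \<psi>') ^ 3)"
    by (rule mult_left_cancel[OF nz(1), THEN iffD1])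
  then have "section_mod_3 0 (P1 * (f1 ^ 2 * f4) ^ 3) = section_mod_3 0 (- (\<phi> ^ 2 * (f2 ^ 3 * \<psi>') ^ 3))"
    by (rule arg_cong)
  then have R: "section_mod_3 0 P1 * (f1 ^ 2 * f4) = - (\<phi> ^ 6 * (f2 ^ 3 * \<psi>'))"
    using section_mod_3_0_phi_square by (simp add: section_mod_3_mult_cube section_mod_3_minus \<phi>_def)

  \<comment> \<open>The factor \<open>g\<close> serves to trade \<psi>(-q) for \<psi>(q), as
    \<open>\<psi>' * g\<close> and \<open>\<psi> * f1\<close> are equal.\<close>
  have "(f1 * f2 ^ 3) * section_mod_3 0 P1 = (section_mod_3 0 P1 * (f1 ^ 2 * f4)) * g"
    unfolding g[symmetric] by algebra
  also have "\<dots> = - (\<phi> ^ 6 * f2 ^ 3) * (\<psi>' * g)"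
    unfolding R by algebra
  also have "\<dots> = - (\<phi> ^ 6 * f2 ^ 3) * (\<psi> * f1)"
    unfolding psi psi' ..
  also have "\<dots> = (f1 * f2 ^ 3) * reduced_fps"
    unfolding reduced_fps_def \<psi>_def \<phi>_def by algebra
  finally show ?thesis
    using nz by (simp add: P1_def)
qed

lemma pend_eq_reduced_fps_nth: "of_nat (pend (9 * n + 1)) = fps_nth reduced_fps n"
  unfolding section_mod_3_pend[symmetric] by (simp add: pend_fps_def)

text \<open>Passing from k to 9k + 1 multiplies 8k + 1 by 9, and k = 3n + 2 gives 24n + 17.\<close>

lemma reduced_fps_nth_eq_0:
  "8 * k + 1 = 9 ^ a * (24 * n + 17) \<Longrightarrow> fps_nth reduced_fps k = 0"
proof (induction a arbitrary: k)
  case 0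
  then have "k = 3 * n + 2" by simp
  then show ?case by (simp only: reduced_fps_nth_2)
next
  case (Suc a)
  then have "8 * k + 1 = 9 * (9 ^ a * (24 * n + 17))" by simp
  then have "k mod 9 = 1" by presburger
  then obtain j where j: "k = 9 * j + 1"
    by (metis mult.commute div_mult_mod_eq)
  with Suc.prems have "8 * j + 1 = 9 ^ a * (24 * n + 17)"
    by simp
  with Suc.IH j show ?case by (simp only: reduced_fps_nth_1)
qed

theorem theorem6:
  fixes \<alpha> n :: nat
  assumes "\<alpha> \<ge> 1"
  shows "[pend (3 ^ (2 * \<alpha> + 1) * n + (17 * 3 ^ (2 * \<alpha>) - 1) div 8) = 0] (mod 3)"
proof -
  define N where "N = 3 ^ (2 * \<alpha> + 1) * n + (17 * 3 ^ (2 * \<alpha>) - 1) div 8"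
  \<comment> \<open>One factor 9 is spent on passing from \<open>pend\<close> to
    \<open>reduced_fps\<close>; the other \<open>a\<close> feed the induction.\<close>
  obtain a where a: "\<alpha> = Suc a"
    using assms by (cases \<alpha>) auto
  have "8 * ((17 * 3 ^ (2 * \<alpha>) - 1) div 8) = 17 * 3 ^ (2 * \<alpha>) - (1 :: nat)"
    using eight_dvd by (rule dvd_mult_div_cancel)
  moreover have "(1 :: nat) \<le> 17 * 3 ^ (2 * \<alpha>)" by simp
  ultimately have "8 * ((17 * 3 ^ (2 * \<alpha>) - 1) div 8) + 1 = (17 * 3 ^ (2 * \<alpha>) :: nat)"
    by (simp only: le_add_diff_inverse2)
  then have "8 * N + 1 = 8 * (3 ^ (2 * \<alpha> + 1) * n) + 17 * 3 ^ (2 * \<alpha>)"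
    by (simp only: N_def distrib_left add.assoc)
  also have "(3 :: nat) ^ (2 * \<alpha>) = 9 * 9 ^ a"
    by (simp only: a power_mult) simp
  also have "(3 :: nat) ^ (2 * \<alpha> + 1) = 3 * (9 * 9 ^ a)"
    by (simp only: a power_add power_mult) simp
  also have "8 * (3 * (9 * 9 ^ a) * n) + 17 * (9 * 9 ^ a) = 9 * (9 ^ a * (24 * n + 17))"
    by (simp add: algebra_simps)
  finally have N: "8 * N + 1 = 9 * (9 ^ a * (24 * n + 17))" .
  then have "N mod 9 = 1" by presburger
  then obtain k where k: "N = 9 * k + 1"
    by (metis mult.commute div_mult_mod_eq)
  with N have "fps_nth reduced_fps k = 0"
    by (intro reduced_fps_nth_eq_0[of k a n]) simp
  then have "(of_nat (pend N) :: gf3) = 0"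
    by (simp only: k pend_eq_reduced_fps_nth)
  then have "3 dvd pend N"
    by (simp add: of_nat_eq_0_iff_char_dvd CHAR_gf3)
  then show ?thesis
    unfolding N_def by (simp add: cong_0_iff)
qed

end
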